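(* Let $n\ge2$ be an integer, $N=2n$, $m_0\in\{+1,-1\}$, $m_j=m_0$ and $m_{n+j}=-m_0$ for $1\le j\le n$. Let $0\le\theta_0<2\pi$, $0<a_1<a_2$, $\theta_n^j=\frac{2(j-1)\pi}{n}+\theta_0$ and $\alpha_n^j=\frac{2(j-1)\pi}{n}+\frac{\pi}{n}+\theta_0$ for $1\le j\le n$. Consider the system $$\dot{\mathbf x}_j(t)=2m_j\sum_{k=1,k\ne j}^N m_k\frac{\mathbf x_j(t)-\mathbf x_k(t)}{|\mathbf x_j(t)-\mathbf x_k(t)|^2},\qquad 1\le j\le N,$$ with initial data $\mathbf x_j(0)=a_1(\cos\theta_n^j,\sin\theta_n^j)^T$, $\mathbf x_{n+j}(0)=a_2(\cos\alpha_n^j,\sin\alpha_n^j)^T$, $1\le j\le n$. Then the solution is $$\mathbf x_j(t)=\sqrt{\rho_1(t)}\,(\cos\theta_n^j,\sin\theta_n^j)^T,\qquad \mathbf x_{n+j}(t)=\sqrt{\rho_2(t)}\,(\cos\alpha_n^j,\sin\alpha_n^j)^T,\qquad 1\le j\le n,$$ where $$\rho_1(t)>0,\quad \rho_2(t)>0,\quad 0\le t<T_c:=\tfrac14(a_1^2+a_2^2),\qquad \lim_{t\to T_c^-}\rho_1(t)=\lim_{t\to T_c^-}\rho_2(t)=0,$$ which implies that the $N=2n$ vortices form a (finite time) collision cluster.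
   Context: All $N$ vortices form a (finite time) collision cluster if there are a finite time $0<T_c<+\infty$ and a point $\mathbf x^0\in\mathbb R^2$ such that $\min_{1\le j<l\le N}|\mathbf x_j(t)-\mathbf x_l(t)|>0$ for $0\le t<T_c$ and $\lim_{t\to T_c^-}\mathbf x_j(t)=\mathbf x^0$ for all $1\le j\le N$. *)

theory Defs
  imports "HOL-Analysis.Analysis"
begin

text \<open>Vortices are numbered \<open>1, \<dots>, N\<close>; \<open>x j t\<close> is the position of vortex \<open>j\<close> at time \<open>t\<close>. Values at
  indices outside \<open>{1..N}\<close> or at times outside the interval under consideration are irrelevant.\<close>

definition vortex_velocity :: "nat \<Rightarrow> (nat \<Rightarrow> real) \<Rightarrow> (nat \<Rightarrow> real^2) \<Rightarrow> nat \<Rightarrow> real^2" where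
  "vortex_velocity N m p j =
     (2 * m j) *\<^sub>R (\<Sum>k\<in>{1..N} - {j}. (m k / (norm (p j - p k))\<^sup>2) *\<^sub>R (p j - p k))"

text \<open>Distinctness of the positions is part of being a solution, because the right-hand side is
  undefined at coinciding positions, whereas division by zero is total in HOL. The derivative is
  one-sided at time \<open>0\<close> and the ordinary one at every later time.\<close>

definition vortex_solution ::
  "nat \<Rightarrow> (nat \<Rightarrow> real) \<Rightarrow> (nat \<Rightarrow> real^2) \<Rightarrow> real \<Rightarrow> (nat \<Rightarrow> real \<Rightarrow> real^2) \<Rightarrow> bool" where
  "vortex_solution N m p0 T x \<longleftrightarrow>
     0 < T \<and>
     (\<forall>j\<in>{1..N}. x j 0 = p0 j) \<and>
     (\<forall>t\<in>{0..<T}.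
        (\<forall>j\<in>{1..N}. \<forall>k\<in>{1..N}. j \<noteq> k \<longrightarrow> x j t \<noteq> x k t) \<and>
        (\<forall>j\<in>{1..N}. (x j has_vector_derivative vortex_velocity N m (\<lambda>k. x k t) j)
                       (at t within {0..<T})))"

text \<open>``The'' solution of the initial value problem: a solution on \<open>[0, T)\<close> of which every other
  solution with the same initial data is a restriction. Solutions on \<open>[0, \<infinity>)\<close> need no separate
  treatment, since they restrict to solutions on every bounded interval \<open>[0, S)\<close>.\<close>

definition unique_maximal_vortex_solution ::
  "nat \<Rightarrow> (nat \<Rightarrow> real) \<Rightarrow> (nat \<Rightarrow> real^2) \<Rightarrow> real \<Rightarrow> (nat \<Rightarrow> real \<Rightarrow> real^2) \<Rightarrow> bool" where
  "unique_maximal_vortex_solution N m p0 T x \<longleftrightarrow>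
     vortex_solution N m p0 T x \<and>
     (\<forall>S y. vortex_solution N m p0 S y \<longrightarrow>
        S \<le> T \<and> (\<forall>j\<in>{1..N}. \<forall>t\<in>{0..<S}. y j t = x j t))"

definition collision_cluster :: "nat \<Rightarrow> (nat \<Rightarrow> real \<Rightarrow> real^2) \<Rightarrow> bool" where
  "collision_cluster N x \<longleftrightarrow>
     (\<exists>Tc > 0. \<exists>p :: real^2.
        (\<forall>t\<in>{0..<Tc}. Min {norm (x j t - x l t) |j l. 1 \<le> j \<and> j < l \<and> l \<le> N} > 0) \<and>
        (\<forall>j\<in>{1..N}. (x j \<longlongrightarrow> p) (at_left Tc)))"

definition unit_vec :: "real \<Rightarrow> real^2" where
  "unit_vec \<phi> = vector [cos \<phi>, sin \<phi>]"

end

theory Submission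
  imports Defs
begin

text \<open>In complex notation the rotational symmetry reduces the system to two radii: for \<open>z\<close> on one ring,
  the sum of \<open>1 / (z - w)\<close> over the other points \<open>w\<close> of its own ring is \<open>(n - 1) / (2 z)\<close>, and over
  the other ring, the roots of \<open>w\<^sup>n = b\<close>, it is \<open>n z\<^bsup>n-1\<^esup> / (z\<^sup>n - b)\<close>. So each vortex moves
  radially and the squared radii satisfy \<open>(\<rho>\<^sub>1 + \<rho>\<^sub>2)' = - 4\<close>, while \<open>\<rho>\<^sub>1 / \<rho>\<^sub>2\<close> increases but stays
  below \<open>1\<close>; hence both remain positive until they vanish together at \<open>T\<^sub>c\<close>. Uniqueness is Gronwall's
  inequality, and no solution outlives \<open>T\<^sub>c\<close> because all vortices would coincide there.\<close>

section \<open>Scalar differential equations\<close>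

text \<open>Separation of variables: the time needed to travel from \<open>x0\<close> to
  \<open>x\<close> is the integral of \<open>1 / f\<close>, and \<open>u\<close> is the inverse of
  this increasing function. The linear bound on \<open>f\<close> near \<open>b\<close> makes the
  travel time unbounded, so \<open>u\<close> lives for all times and never reaches
  \<open>b\<close>.\<close>

lemma autonomous_ode_exists:
  fixes f :: "real \<Rightarrow> real"
  assumes cont: "continuous_on {a<..<b} f"
    and pos: "\<And>x. a < x \<Longrightarrow> x < b \<Longrightarrow> 0 < f x"
    and bound: "\<And>x. x0 \<le> x \<Longrightarrow> x < b \<Longrightarrow> f x \<le> C * (b - x)"
    and x0: "a < x0" "x0 < b"
  obtains u where "u 0 = x0"
    and "\<And>t. 0 \<le> t \<Longrightarrow> a < u t \<and> u t < b"
    and "\<And>t. 0 \<le> t \<Longrightarrow> (u has_real_derivative f (u t)) (at t)"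
proof -
  \<comment> \<open>Starting the integral strictly to the left of \<open>x0\<close> makes
    \<open>x0\<close> an interior point, so that \<open>u\<close> has a two-sided derivative even at
    time \<open>0\<close>.\<close>
  define c where "c = (a + x0) / 2"
  have c: "a < c" "c < x0" using x0 by (auto simp: c_def)
  define F where "F x = integral {c..x} (\<lambda>v. 1 / f v)" for x
  have dF: "(F has_real_derivative 1 / f x) (at x)" if x: "c < x" "x < b" for x
  proof -
    define d where "d = (x + b) / 2"
    have d: "x < d" "d < b" using x by (auto simp: d_def)
    have "f v \<noteq> 0" if "v \<in> {c..d}" for v
      using pos[of v] that c d by force
    moreover have "continuous_on {c..d} f"
      by (rule continuous_on_subset[OF cont]) (use c d in auto)
    ultimately have "continuous_on {c..d} (\<lambda>v. 1 / f v)"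
      by (intro continuous_intros) auto
    from integral_has_real_derivative[OF this, of x]
    have "(F has_real_derivative 1 / f x) (at x within {c..d})"
      using x d by (simp add: F_def[abs_def])
    moreover have "at x within {c..d} = at x"
      by (rule at_within_Icc_at) (use x d in auto)
    ultimately show ?thesis by simp
  qed
  define G where "G x = F x - F x0" for x
  have dG: "(G has_real_derivative 1 / f x) (at x)" if "c < x" "x < b" for x
    unfolding G_def[abs_def] by (auto intro!: derivative_eq_intros dF that)
  have contG: "continuous_on {c<..<b} G"
    by (intro continuous_at_imp_continuous_on ballI DERIV_isCont[OF dG]) auto
  have mono: "G x < G y" if "c < x" "x < y" "y < b" for x y
  proof (rule DERIV_pos_imp_increasing[OF \<open>x < y\<close>])
    fix z assume "x \<le> z" "z \<le> y"
    then show "\<exists>y. (G has_real_derivative y) (at z) \<and> 0 < y"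
      using dG[of z] pos[of z] that c by (intro exI[of _ "1 / f z"]) auto
  qed
  have inj: "inj_on G {c<..<b}"
    by (rule linorder_inj_onI) (use mono in \<open>force+\<close>)
  have Cpos: "C > 0"
    using bound[of x0] pos[of x0] x0 by (smt (verit) mult_nonneg_nonneg mult_nonpos_nonneg)
  have surj: "\<exists>x. c < x \<and> x < b \<and> G x = t" if "0 \<le> t" for t
  proof -
    \<comment> \<open>\<open>E\<close> is the distance to \<open>b\<close> that remains at time
      \<open>t\<close> for the comparison equation \<open>x' = C * (b - x)\<close>. Since
      \<open>f\<close> is no faster, \<open>u\<close> cannot pass \<open>x1\<close> before time
      \<open>t\<close>.\<close>
    define E where "E = (b - x0) * exp (- (C * t))"
    define x1 where "x1 = b - E"
    have "exp (- (C * t)) \<le> 1" using Cpos that by simp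
    then have "E \<le> b - x0"
      using x0 mult_left_mono[of "exp (- (C * t))" 1 "b - x0"] by (simp add: E_def)
    moreover have "0 < E" using x0 by (simp add: E_def)
    ultimately have x1: "x0 \<le> x1" "x1 < b" by (simp_all add: x1_def)
    \<comment> \<open>The comparison equation has travel time \<open>- ln (b - x) / C\<close> up to
      a constant, and \<open>1 / f\<close> dominates its derivative
      \<open>1 / (C * (b - x))\<close>.\<close>
    have "G x0 + ln (b - x0) / C \<le> G x1 + ln (b - x1) / C"
    proof (rule DERIV_nonneg_imp_nondecreasing[OF \<open>x0 \<le> x1\<close>])
      fix z assume z: "x0 \<le> z" "z \<le> x1"
      have "((\<lambda>x. ln (b - x) / C) has_real_derivative - (1 / (C * (b - z)))) (at z)"
        using z x1 Cpos by (auto intro!: derivative_eq_intros simp: divide_simps)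
      then have "((\<lambda>x. G x + ln (b - x) / C) has_real_derivative 1 / f z + - (1 / (C * (b - z)))) (at z)"
        using z x1 c by (intro DERIV_add dG) auto
      moreover have "1 / (C * (b - z)) \<le> 1 / f z"
        using bound[of z] pos[of z] z x0 x1 by (intro divide_left_mono mult_pos_pos Cpos) auto
      ultimately show "\<exists>y. ((\<lambda>x. G x + ln (b - x) / C) has_real_derivative y) (at z) \<and> 0 \<le> y"
        by (intro exI[of _ "1 / f z + - (1 / (C * (b - z)))"]) auto
    qed
    moreover have "ln (b - x1) = ln (b - x0) - C * t"
      using x0 by (simp add: x1_def E_def ln_mult)
    ultimately have "t \<le> G x1"
      using Cpos by (simp add: G_def diff_divide_distrib)
    moreover have "G x0 \<le> t" using that by (simp add: G_def)
    moreover have "continuous_on {x0..x1} G"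
      by (rule continuous_on_subset[OF contG]) (use c x1 in auto)
    ultimately obtain x where "x0 \<le> x" "x \<le> x1" "G x = t"
      using IVT'[of G x0 t x1] x1 by auto
    then show ?thesis using c x1 by (intro exI[of _ x]) auto
  qed
  define u where "u = the_inv_into {c<..<b} G"
  have uG: "u (G x) = x" if "x \<in> {c<..<b}" for x
    using the_inv_into_f_f[OF inj that] by (simp add: u_def)
  show thesis
  proof
    show "u 0 = x0" using uG[of x0] c x0 by (simp add: G_def)
  next
    fix t :: real assume "0 \<le> t"
    then obtain x where x: "c < x" "x < b" "G x = t" using surj by blast
    then have ut: "u t = x" using uG[of x] by auto
    show "a < u t \<and> u t < b" using x c ut by simp
    have "(u has_derivative (*) (f x)) (at (G x))"
    proof (rule has_derivative_inverse_strong[where S = "{c<..<b}" and f = G and f' = "(*) (1 / f x)"])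
      show "(G has_derivative (*) (1 / f x)) (at x)"
        using dG[OF x(1,2)] by (simp add: has_field_derivative_def)
      show "(*) (1 / f x) \<circ> (*) (f x) = id"
        using pos[of x] x c by (auto simp: fun_eq_iff)
    qed (use x contG uG in auto)
    then show "(u has_real_derivative f (u t)) (at t)"
      by (simp add: has_field_derivative_def ut x)
  qed
qed

text \<open>This is the distance distortion of inversion in the unit sphere, checked by expanding
  both squares into inner products. It makes the interaction kernel Lipschitz away from the
  origin.\<close>

lemma norm_diff_inversion:
  fixes v w :: "'a::real_inner"
  assumes "v \<noteq> 0" "w \<noteq> 0"
  shows "norm ((1 / (norm v)\<^sup>2) *\<^sub>R v - (1 / (norm w)\<^sup>2) *\<^sub>R w) = norm (v - w) / (norm v * norm w)"
proof -
  have vw: "v \<bullet> v \<noteq> 0" "w \<bullet> w \<noteq> 0" using assms by auto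
  have "(norm ((1 / (norm v)\<^sup>2) *\<^sub>R v - (1 / (norm w)\<^sup>2) *\<^sub>R w))\<^sup>2 = (norm (v - w) / (norm v * norm w))\<^sup>2"
    unfolding power_divide power_mult_distrib power2_norm_eq_inner inner_diff_left inner_diff_right
      inner_scaleR_left inner_scaleR_right inner_commute[of w v]
    using vw by (simp add: field_simps)
  then show ?thesis by (simp add: power2_eq_iff_nonneg)
qed

text \<open>The function \<open>D t * exp (- (K * t))\<close> is nonincreasing and starts at zero,
  which forces \<open>D b \<le> 0\<close>.\<close>

lemma gronwall_zero:
  fixes D D' :: "real \<Rightarrow> real"
  assumes "0 \<le> b"
    and deriv: "\<And>t. t \<in> {0..b} \<Longrightarrow> (D has_real_derivative D' t) (at t within {0..b})"
    and le: "\<And>t. t \<in> {0..b} \<Longrightarrow> D' t \<le> K * D t"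
    and D0: "D 0 = 0" and nonneg: "0 \<le> D b"
  shows "D b = 0"
proof -
  have "D b * exp (- (K * b)) \<le> D 0 * exp (- (K * 0))"
  proof (rule DERIV_nonpos_imp_decreasing_open[OF \<open>0 \<le> b\<close>])
    fix t assume t: "0 < t" "t < b"
    have "(D has_real_derivative D' t) (at t)"
      using deriv[of t] t at_within_Icc_at[of 0 t b] by auto
    then have "((\<lambda>t. D t * exp (- (K * t))) has_real_derivative
        (D' t - K * D t) * exp (- (K * t))) (at t)"
      by (auto intro!: derivative_eq_intros simp: algebra_simps)
    moreover have "(D' t - K * D t) * exp (- (K * t)) \<le> 0"
      using le[of t] t by (intro mult_nonpos_nonneg) auto
    ultimately show "\<exists>y. ((\<lambda>t. D t * exp (- (K * t))) has_real_derivative y) (at t) \<and> y \<le> 0"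
      by blast
  next
    have "continuous_on {0..b} D"
      using deriv by (meson DERIV_continuous continuous_on_eq_continuous_within)
    then show "continuous_on {0..b} (\<lambda>t. D t * exp (- (K * t)))"
      by (intro continuous_intros)
  qed
  then show ?thesis using D0 nonneg by (simp add: mult_le_0_iff)
qed

section \<open>Uniqueness of vortex solutions\<close>

text \<open>A Lipschitz estimate for separated configurations: each summand is an inversion, the two
  arguments differ by at most \<open>2 * E\<close>, and the product of their norms is at least the
  square of \<delta>.\<close>

lemma norm_vortex_velocity_diff_le:
  assumes "0 < \<delta>"
    and p: "\<And>k. k \<in> {1..N} - {j} \<Longrightarrow> \<delta> \<le> norm (p j - p k)"
    and q: "\<And>k. k \<in> {1..N} - {j} \<Longrightarrow> \<delta> \<le> norm (q j - q k)"
    and E: "\<And>k. k \<in> {1..N} \<Longrightarrow> norm (p k - q k) \<le> E"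
    and j: "j \<in> {1..N}"
  shows "norm (vortex_velocity N m p j - vortex_velocity N m q j)
    \<le> 2 * \<bar>m j\<bar> * (\<Sum>k\<in>{1..N} - {j}. \<bar>m k\<bar> * (2 / \<delta>\<^sup>2)) * E"
proof -
  let ?F = "\<lambda>v :: real^2. (1 / (norm v)\<^sup>2) *\<^sub>R v"
  have "vortex_velocity N m p j - vortex_velocity N m q j
      = (2 * m j) *\<^sub>R (\<Sum>k\<in>{1..N} - {j}. m k *\<^sub>R (?F (p j - p k) - ?F (q j - q k)))"
    by (simp add: vortex_velocity_def scaleR_diff_right sum_subtractf)
  moreover have "norm (m k *\<^sub>R (?F (p j - p k) - ?F (q j - q k))) \<le> \<bar>m k\<bar> * (2 / \<delta>\<^sup>2) * E"
    if k: "k \<in> {1..N} - {j}" for k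
  proof -
    have "norm (p j - p k - (q j - q k)) \<le> norm (p j - q j) + norm (p k - q k)"
      using norm_triangle_ineq4[of "p j - q j" "p k - q k"] by (simp add: algebra_simps)
    also have "\<dots> \<le> 2 * E" using E[OF j] E[of k] k by simp
    finally have "norm (p j - p k - (q j - q k)) \<le> 2 * E" .
    moreover have "\<delta>\<^sup>2 \<le> norm (p j - p k) * norm (q j - q k)"
      unfolding power2_eq_square using p[OF k] q[OF k] \<open>0 < \<delta>\<close> by (intro mult_mono) auto
    moreover have "p j - p k \<noteq> 0" "q j - q k \<noteq> 0" using p[OF k] q[OF k] \<open>0 < \<delta>\<close> by force+
    moreover have "0 \<le> E" using E[OF j] norm_ge_zero order_trans by blast
    ultimately have "norm (?F (p j - p k) - ?F (q j - q k)) \<le> 2 * E / \<delta>\<^sup>2"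
      using \<open>0 < \<delta>\<close> unfolding norm_diff_inversion[OF \<open>p j - p k \<noteq> 0\<close> \<open>q j - q k \<noteq> 0\<close>]
      by (intro frac_le) auto
    then have "\<bar>m k\<bar> * norm (?F (p j - p k) - ?F (q j - q k)) \<le> \<bar>m k\<bar> * (2 * E / \<delta>\<^sup>2)"
      by (rule mult_left_mono) simp
    then show ?thesis by simp
  qed
  then have "norm (\<Sum>k\<in>{1..N} - {j}. m k *\<^sub>R (?F (p j - p k) - ?F (q j - q k)))
      \<le> (\<Sum>k\<in>{1..N} - {j}. \<bar>m k\<bar> * (2 / \<delta>\<^sup>2) * E)"
    by (intro sum_norm_le) auto
  then have "\<bar>2 * m j\<bar> * norm (\<Sum>k\<in>{1..N} - {j}. m k *\<^sub>R (?F (p j - p k) - ?F (q j - q k)))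
      \<le> \<bar>2 * m j\<bar> * (\<Sum>k\<in>{1..N} - {j}. \<bar>m k\<bar> * (2 / \<delta>\<^sup>2) * E)"
    by (rule mult_left_mono) simp
  ultimately show ?thesis
    by (simp only: norm_scaleR sum_distrib_right[symmetric] abs_mult abs_numeral mult.assoc)
qed

lemma vortex_solution_continuous_on:
  assumes "vortex_solution N m p0 T x" "j \<in> {1..N}"
  shows "continuous_on {0..<T} (x j)"
  using assms unfolding vortex_solution_def continuous_on_eq_continuous_within
  by (blast intro: has_vector_derivative_continuous)

text \<open>By compactness of \<open>{0..b}\<close> each pairwise distance attains a positive
  minimum, and there are only finitely many pairs.\<close>

lemma vortex_solution_separated:
  assumes x: "vortex_solution N m p0 T x" and b: "0 \<le> b" "b < T"
  obtains \<delta> where "0 < \<delta>"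
    "\<And>t j k. t \<in> {0..b} \<Longrightarrow> j \<in> {1..N} \<Longrightarrow> k \<in> {1..N} - {j} \<Longrightarrow> \<delta> \<le> norm (x j t - x k t)"
proof -
  define P where "P = {(j, k). j \<in> {1..N} \<and> k \<in> {1..N} - {j}}"
  have finP: "finite P" by (rule finite_subset[of _ "{1..N} \<times> {1..N}"]) (auto simp: P_def)
  have "\<exists>d>0. \<forall>t\<in>{0..b}. d \<le> norm (x (fst e) t - x (snd e) t)" if e: "e \<in> P" for e
  proof -
    let ?f = "\<lambda>t. norm (x (fst e) t - x (snd e) t)"
    have "continuous_on {0..b} (x i)" if "i \<in> {1..N}" for i
      using vortex_solution_continuous_on[OF x that] by (rule continuous_on_subset) (use b in auto)
    then have "continuous_on {0..b} ?f"
      using e by (intro continuous_intros) (auto simp: P_def)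
    then obtain s where s: "s \<in> {0..b}" "\<And>t. t \<in> {0..b} \<Longrightarrow> ?f s \<le> ?f t"
      using continuous_attains_inf[of "{0..b}" ?f] b by auto
    have "x (fst e) s \<noteq> x (snd e) s"
      using x e s(1) b unfolding vortex_solution_def P_def by force
    then show ?thesis using s(2) by (intro exI[of _ "?f s"]) auto
  qed
  then obtain d where d: "\<And>e. e \<in> P \<Longrightarrow> 0 < d e"
    "\<And>e t. e \<in> P \<Longrightarrow> t \<in> {0..b} \<Longrightarrow> d e \<le> norm (x (fst e) t - x (snd e) t)"
    by metis
  show thesis
  proof
    \<comment> \<open>The inserted \<open>1\<close> keeps the minimum meaningful when there are no
      pairs, that is for \<open>N \<le> 1\<close>.\<close>
    show "0 < Min (insert 1 (d ` P))" using finP d(1) by simp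
    fix t j k assume "t \<in> {0..b}" "j \<in> {1..N}" "k \<in> {1..N} - {j}"
    moreover from this have "(j, k) \<in> P" by (simp add: P_def)
    moreover from this have "Min (insert 1 (d ` P)) \<le> d (j, k)"
      using finP by (intro Min_le) auto
    ultimately show "Min (insert 1 (d ` P)) \<le> norm (x j t - x k t)"
      using d(2)[of "(j, k)" t] by simp
  qed
qed

text \<open>Up to time \<open>b\<close> both solutions stay away from collisions, where the velocity
  is Lipschitz. Gronwall's inequality then applies to the sum \<open>D\<close> of the squared
  position errors.\<close>

lemma vortex_solution_unique:
  assumes x: "vortex_solution N m p0 T x" and y: "vortex_solution N m p0 S y"
    and b: "0 \<le> b" "b < T" "b < S" and j: "j \<in> {1..N}"
  shows "y j b = x j b"
proof -
  define e where "e i t = y i t - x i t" for i t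
  define v where "v i t = vortex_velocity N m (\<lambda>k. y k t) i - vortex_velocity N m (\<lambda>k. x k t) i" for i t
  define D where "D t = (\<Sum>i\<in>{1..N}. e i t \<bullet> e i t)" for t
  obtain \<delta>1 where \<delta>1: "0 < \<delta>1" "\<And>t j k. t \<in> {0..b} \<Longrightarrow> j \<in> {1..N} \<Longrightarrow> k \<in> {1..N} - {j} \<Longrightarrow>
      \<delta>1 \<le> norm (x j t - x k t)"
    using vortex_solution_separated[OF x b(1,2)] by blast
  obtain \<delta>2 where \<delta>2: "0 < \<delta>2" "\<And>t j k. t \<in> {0..b} \<Longrightarrow> j \<in> {1..N} \<Longrightarrow> k \<in> {1..N} - {j} \<Longrightarrow>
      \<delta>2 \<le> norm (y j t - y k t)"
    using vortex_solution_separated[OF y b(1,3)] by blast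
  \<comment> \<open>The Lipschitz estimate needs one separation constant valid for both
    configurations.\<close>
  define \<delta> where "\<delta> = min \<delta>1 \<delta>2"
  define L where "L i = 2 * \<bar>m i\<bar> * (\<Sum>k\<in>{1..N} - {i}. \<bar>m k\<bar> * (2 / \<delta>\<^sup>2))" for i
  have D_nonneg: "0 \<le> D t" for t by (simp add: D_def sum_nonneg)
  have "D b = 0"
  proof (rule gronwall_zero[OF b(1)])
    fix t assume t: "t \<in> {0..b}"
    have "(e i has_vector_derivative v i t) (at t within {0..b})" if "i \<in> {1..N}" for i
    proof -
      have "(x i has_vector_derivative vortex_velocity N m (\<lambda>k. x k t) i) (at t within {0..b})"
        "(y i has_vector_derivative vortex_velocity N m (\<lambda>k. y k t) i) (at t within {0..b})"
        using x y that t b unfolding vortex_solution_def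
        by (auto intro: has_vector_derivative_within_subset[of _ _ _ "{0..<T}"]
            has_vector_derivative_within_subset[of _ _ _ "{0..<S}"])
      then show ?thesis
        unfolding e_def[abs_def] v_def by (intro has_vector_derivative_diff)
    qed
    then have "((\<lambda>t. e i t \<bullet> e i t) has_real_derivative 2 * (e i t \<bullet> v i t)) (at t within {0..b})"
      if "i \<in> {1..N}" for i
      using bounded_bilinear.has_vector_derivative[OF bounded_bilinear_inner, of "e i" "v i t" t "{0..b}" "e i" "v i t"] that
      by (simp add: has_real_derivative_iff_has_vector_derivative inner_commute)
    then show "(D has_real_derivative (\<Sum>i\<in>{1..N}. 2 * (e i t \<bullet> v i t))) (at t within {0..b})"
      unfolding D_def[abs_def] by (intro DERIV_sum) auto
    \<comment> \<open>Thus \<open>sqrt (D t)\<close> can serve as the common error bound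
      \<open>E\<close> in the Lipschitz estimate, which makes the final bound linear in
      \<open>D t\<close>.\<close>
    have le: "norm (e i t) \<le> sqrt (D t)" if "i \<in> {1..N}" for i
      unfolding norm_eq_sqrt_inner D_def
      by (intro real_sqrt_le_mono member_le_sum) (use that in auto)
    have "2 * (e i t \<bullet> v i t) \<le> 2 * L i * D t" if i: "i \<in> {1..N}" for i
    proof -
      have "e i t \<bullet> v i t \<le> norm (e i t) * norm (v i t)" by (rule norm_cauchy_schwarz)
      also have "\<dots> \<le> sqrt (D t) * (L i * sqrt (D t))"
      proof (intro mult_mono le[OF i])
        show "norm (v i t) \<le> L i * sqrt (D t)"
          unfolding v_def L_def
          by (rule norm_vortex_velocity_diff_le)
             (use \<delta>1(1) \<delta>2(1) \<delta>1(2)[OF t i] \<delta>2(2)[OF t i] le i in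
              \<open>auto simp: \<delta>_def e_def min_le_iff_disj\<close>)
      qed (simp_all add: D_nonneg)
      also have "\<dots> = L i * D t" using D_nonneg[of t] by (simp add: mult_ac)
      finally show ?thesis by simp
    qed
    then show "(\<Sum>i\<in>{1..N}. 2 * (e i t \<bullet> v i t)) \<le> (\<Sum>i\<in>{1..N}. 2 * L i) * D t"
      unfolding sum_distrib_right by (rule sum_mono)
  next
    show "D 0 = 0"
      using x y by (simp add: D_def e_def vortex_solution_def)
  qed (rule D_nonneg)
  then have "e j b \<bullet> e j b = 0"
    using j unfolding D_def by (subst (asm) sum_nonneg_eq_0_iff) auto
  then show ?thesis by (simp add: e_def)
qed

section \<open>Sums over regular polygons\<close>

definition complex_vec :: "complex \<Rightarrow> real^2" where
  "complex_vec z = vector [Re z, Im z]"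

lemma complex_vec_diff: "complex_vec (z - w) = complex_vec z - complex_vec w"
  by (simp add: complex_vec_def vec_eq_iff forall_2)

lemma linear_complex_vec: "linear complex_vec"
  by (rule linearI) (simp_all add: complex_vec_def vec_eq_iff forall_2)

lemma norm_complex_vec: "norm (complex_vec z) = cmod z"
  by (simp add: complex_vec_def norm_vec_def L2_set_def sum_2 cmod_def)

lemma complex_vec_rcis: "complex_vec (of_real r * cis \<phi>) = r *\<^sub>R unit_vec \<phi>"
  by (simp add: complex_vec_def unit_vec_def vec_eq_iff forall_2)

lemma complex_vec_eq_iff: "complex_vec z = complex_vec w \<longleftrightarrow> z = w"
  using norm_complex_vec[of "z - w"] by (auto simp: complex_vec_diff)

text \<open>The kernel \<open>w / |w|^2\<close> is the conjugate of \<open>1 / w\<close>, so the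
  interaction becomes a sum of inverses that can be evaluated algebraically over roots.\<close>

lemma vortex_velocity_complex_vec:
  "vortex_velocity N m (\<lambda>k. complex_vec (Z k)) j =
     complex_vec (of_real (2 * m j) * cnj (\<Sum>k\<in>{1..N} - {j}. of_real (m k) * inverse (Z j - Z k)))"
proof -
  have *: "(c / (norm (complex_vec w))\<^sup>2) *\<^sub>R complex_vec w = complex_vec (of_real c * cnj (inverse w))" for c w
  proof -
    have "(c / (cmod w)\<^sup>2) *\<^sub>R w = of_real c * cnj (inverse w)"
    proof (cases "w = 0")
      case False
      have "of_real ((cmod w)\<^sup>2) = w * cnj w" by (simp only: complex_norm_square)
      then show ?thesis
        using False by (simp add: scaleR_conv_of_real divide_simps del: of_real_power)
    qed simp
    then show ?thesis
      by (metis norm_complex_vec linear_scale[OF linear_complex_vec])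
  qed
  have "vortex_velocity N m (\<lambda>k. complex_vec (Z k)) j = (2 * m j) *\<^sub>R
      complex_vec (\<Sum>k\<in>{1..N} - {j}. of_real (m k) * cnj (inverse (Z j - Z k)))"
    unfolding vortex_velocity_def complex_vec_diff[symmetric] * linear_sum[OF linear_complex_vec] ..
  also have "\<dots> = complex_vec ((2 * m j) *\<^sub>R
      (\<Sum>k\<in>{1..N} - {j}. of_real (m k) * cnj (inverse (Z j - Z k))))"
    by (rule linear_scale[OF linear_complex_vec, symmetric])
  finally show ?thesis by (simp add: scaleR_conv_of_real)
qed

text \<open>The involution \<open>w \<mapsto> z\<^sup>2 / w\<close> permutes the roots other than \<open>z\<close>, and
  \<open>1 / (z - w) + 1 / (z - z\<^sup>2 / w) = 1 / z\<close>.\<close>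
lemma sum_inverse_diff_roots_same:
  fixes z :: complex
  assumes "z \<noteq> 0" "n > 0"
  shows "(\<Sum>w\<in>{w. w ^ n = z ^ n} - {z}. inverse (z - w)) = (of_nat n - 1) / (2 * z)"
proof -
  let ?R = "{w. w ^ n = z ^ n} - {z}"
  have nz: "w \<noteq> 0" if "w \<in> ?R" for w using that assms by (auto simp: power_0_left)
  have "bij_betw (\<lambda>w. z\<^sup>2 / w) ?R ?R"
  proof (rule bij_betw_byWitness[where f' = "\<lambda>w. z\<^sup>2 / w"])
    show "\<forall>w\<in>?R. z\<^sup>2 / (z\<^sup>2 / w) = w" "\<forall>w\<in>?R. z\<^sup>2 / (z\<^sup>2 / w) = w"
      using assms nz by auto
    have "z\<^sup>2 / w \<in> ?R" if "w \<in> ?R" for w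
      using that nz[OF that] assms
      by (auto simp: power_divide field_simps power2_eq_square power_mult_distrib)
    then show "(\<lambda>w. z\<^sup>2 / w) ` ?R \<subseteq> ?R" by (rule image_subsetI)
    then show "(\<lambda>w. z\<^sup>2 / w) ` ?R \<subseteq> ?R" .
  qed
  from sum.reindex_bij_betw[OF this, of "\<lambda>w. inverse (z - w)"]
  have "2 * (\<Sum>w\<in>?R. inverse (z - w)) = (\<Sum>w\<in>?R. inverse (z - w) + inverse (z - z\<^sup>2 / w))"
    by (simp add: sum.distrib)
  also have "\<dots> = (\<Sum>w\<in>?R. inverse z)"
  proof (rule sum.cong[OF refl])
    fix w assume w: "w \<in> ?R"
    define d where "d = w - z"
    have "w \<noteq> 0" "d \<noteq> 0" using w nz by (auto simp: d_def)
    have "z - w = - d" "z - z\<^sup>2 / w = z * d / w"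
      using \<open>w \<noteq> 0\<close> by (simp_all add: d_def field_simps power2_eq_square)
    moreover have "inverse (- d) + inverse (z * d / w) = (w - z) / (z * d)"
      using \<open>w \<noteq> 0\<close> \<open>d \<noteq> 0\<close> assms by (simp add: field_simps)
    moreover have "(w - z) / (z * d) = inverse z"
      unfolding d_def[symmetric] using \<open>d \<noteq> 0\<close> by (simp add: field_simps)
    ultimately show "inverse (z - w) + inverse (z - z\<^sup>2 / w) = inverse z" by simp
  qed
  also have "\<dots> = (of_nat n - 1) / z"
    using assms card_nth_roots[of "z ^ n" n] finite_nth_roots[of n "z ^ n"]
    by (simp add: of_nat_diff field_simps)
  finally show ?thesis using assms by (simp add: field_simps)
qed

text \<open>Multiplication by a primitive \<open>n\<close>-th root of unity \<zeta> permutes the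
  roots, so the sum is unchanged when multiplied by \<open>\<zeta> ^ i\<close>, which differs from
  \<open>1\<close>.\<close>

lemma sum_power_roots_eq_0:
  fixes b :: complex
  assumes "0 < i" "i < n"
  shows "(\<Sum>w\<in>{w. w ^ n = b}. w ^ i) = 0"
proof -
  let ?R = "{w. w ^ n = b}"
  define \<zeta> where "\<zeta> = cis (2 * pi / n)"
  have \<zeta>: "\<zeta> ^ n = 1" "\<zeta> \<noteq> 0" using assms by (simp_all add: \<zeta>_def Complex.DeMoivre)
  have inj: "inj_on (\<lambda>k. cis (2 * pi * real k / real n)) {..<n}"
    using Complex.bij_betw_roots_unity[of n] assms by (auto simp: bij_betw_def)
  have "\<zeta> ^ i \<noteq> 1"
  proof
    assume "\<zeta> ^ i = 1"
    then have "(\<lambda>k. cis (2 * pi * real k / real n)) i = (\<lambda>k. cis (2 * pi * real k / real n)) 0"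
      by (simp add: \<zeta>_def Complex.DeMoivre mult_ac)
    then have "i = 0" by (rule inj_onD[OF inj]) (use assms in auto)
    then show False using assms by simp
  qed
  have "bij_betw ((*) \<zeta>) ?R ?R"
    by (rule bij_betw_byWitness[where f' = "\<lambda>w. w / \<zeta>"])
       (use \<zeta> in \<open>auto simp: power_mult_distrib power_divide\<close>)
  from sum.reindex_bij_betw[OF this, of "\<lambda>w. w ^ i"]
  have "\<zeta> ^ i * (\<Sum>w\<in>?R. w ^ i) = (\<Sum>w\<in>?R. w ^ i)"
    by (simp add: power_mult_distrib sum_distrib_left)
  then show ?thesis using \<open>\<zeta> ^ i \<noteq> 1\<close> by auto
qed

text \<open>Factoring \<open>z ^ n - w ^ n\<close> turns \<open>1 / (z - w)\<close> into a
  polynomial in \<open>w\<close> over the constant \<open>z ^ n - b\<close>. Summed over the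
  \<open>n\<close> roots, only its constant term survives.\<close>

lemma sum_inverse_diff_roots_other:
  fixes z b :: complex
  assumes "z ^ n \<noteq> b" "b \<noteq> 0" "n > 0"
  shows "(\<Sum>w\<in>{w. w ^ n = b}. inverse (z - w)) = of_nat n * z ^ (n - 1) / (z ^ n - b)"
proof -
  let ?R = "{w. w ^ n = b}"
  have "inverse (z - w) = (\<Sum>i<n. z ^ (n - Suc i) * w ^ i) / (z ^ n - b)" if "w \<in> ?R" for w
  proof -
    have "z - w \<noteq> 0" using that assms by auto
    moreover have "z ^ n - b = (z - w) * (\<Sum>i<n. z ^ (n - Suc i) * w ^ i)"
      using that power_diff_sumr2[of w n z] by (simp add: algebra_simps)
    ultimately show ?thesis using assms by (simp add: field_simps)
  qed
  then have "(\<Sum>w\<in>?R. inverse (z - w)) = (\<Sum>w\<in>?R. \<Sum>i<n. z ^ (n - Suc i) * w ^ i) / (z ^ n - b)"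
    by (simp add: sum_divide_distrib)
  also have "(\<Sum>w\<in>?R. \<Sum>i<n. z ^ (n - Suc i) * w ^ i)
      = (\<Sum>i<n. z ^ (n - Suc i) * (\<Sum>w\<in>?R. w ^ i))"
    by (subst sum.swap) (simp add: sum_distrib_left)
  also have "\<dots> = (\<Sum>i<n. if i = 0 then of_nat n * z ^ (n - 1) else 0)"
    using assms by (intro sum.cong) (auto simp: sum_power_roots_eq_0 card_nth_roots)
  also have "\<dots> = of_nat n * z ^ (n - 1)" using assms by simp
  finally show ?thesis .
qed

lemma bij_betw_regular_polygon:
  fixes s :: complex
  assumes "s \<noteq> 0" "n > 0"
  shows "bij_betw (\<lambda>j. s * cis (2 * (real j - 1) * pi / real n)) {1..n} {w. w ^ n = s ^ n}"
proof -
  \<comment> \<open>Vertices are numbered from \<open>1\<close>, roots of unity from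
    \<open>0\<close>; the truncated subtraction is exact on \<open>{1..n}\<close>.\<close>
  have "bij_betw (\<lambda>j. j - 1) {1..n} {..<n}"
    by (rule bij_betw_byWitness[where f' = Suc]) (use assms in auto)
  then have "bij_betw ((\<lambda>k. cis (2 * pi * real k / real n)) \<circ> (\<lambda>j. j - 1)) {1..n} {w. w ^ n = 1}"
    using Complex.bij_betw_roots_unity[OF \<open>n > 0\<close>] by (rule bij_betw_trans)
  moreover have "bij_betw ((*) s) {w. w ^ n = 1} {w. w ^ n = s ^ n}"
    by (rule bij_betw_byWitness[where f' = "\<lambda>w. w / s"])
       (use assms in \<open>auto simp: power_mult_distrib power_divide\<close>)
  ultimately have "bij_betw ((*) s \<circ> ((\<lambda>k. cis (2 * pi * real k / real n)) \<circ> (\<lambda>j. j - 1)))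
      {1..n} {w. w ^ n = s ^ n}"
    by (rule bij_betw_trans)
  then show ?thesis
    by (rule bij_betw_cong[THEN iffD1, rotated]) (auto simp: of_nat_diff mult_ac)
qed

text \<open>Staggering the rings gives their \<open>n\<close>-th powers opposite signs, so
  \<open>z ^ n - b\<close> becomes \<open>(r ^ n + R ^ n) * c\<close> and cannot vanish. The sum of
  inverses is then a real multiple of \<open>1 / z\<close>, which makes the velocity radial.
  Abstract index sets \<open>I\<close> and \<open>J\<close> allow the same lemma to serve either
  ring.\<close>

lemma two_ring_velocity:
  assumes n: "n > 0" and rR: "0 < r" "0 < R" and c: "c \<noteq> 0" and \<mu>: "\<mu>\<^sup>2 = 1"
    and IJ: "{1..N} = I \<union> J" "I \<inter> J = {}"
    and m: "\<And>k. k \<in> I \<Longrightarrow> m k = \<mu>" "\<And>k. k \<in> J \<Longrightarrow> m k = - \<mu>"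
    and ZI: "bij_betw Z I {w. w ^ n = of_real (r ^ n) * c}"
    and ZJ: "bij_betw Z J {w. w ^ n = - of_real (R ^ n) * c}"
    and j: "j \<in> I" "Z j = of_real r * cis \<psi>"
  shows "vortex_velocity N m (\<lambda>k. complex_vec (Z k)) j =
    ((real n - 1 - 2 * real n * r ^ n / (r ^ n + R ^ n)) / r) *\<^sub>R unit_vec \<psi>"
proof -
  let ?z = "Z j"
  have z: "?z \<noteq> 0" using j rR by simp
  have zn: "?z ^ n = of_real (r ^ n) * c" using ZI j(1) by (auto simp: bij_betw_def)
  have sum_pos: "0 < r ^ n + R ^ n" using rR by (simp add: add_pos_pos)
  have diff: "?z ^ n - (- of_real (R ^ n) * c) = of_real (r ^ n + R ^ n) * c"
    by (simp add: zn algebra_simps)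
  have fin: "finite I" "finite J" using IJ by (metis finite_Un finite_atLeastAtMost)+
  have inner: "(\<Sum>k\<in>I - {j}. inverse (?z - Z k)) = (of_nat n - 1) / (2 * ?z)"
  proof -
    have "bij_betw Z (I - {j}) ({w. w ^ n = ?z ^ n} - {?z})"
      using bij_betw_subset[OF ZI, of "I - {j}" "{w. w ^ n = ?z ^ n} - {?z}"] ZI j(1)
      by (auto simp: zn bij_betw_def inj_on_def)
    from sum.reindex_bij_betw[OF this, of "\<lambda>w. inverse (?z - w)"] show ?thesis
      by (simp add: sum_inverse_diff_roots_same[OF z n])
  qed
  define q where "q = real n * r ^ n / (r ^ n + R ^ n)"
  have outer: "(\<Sum>k\<in>J. inverse (?z - Z k)) = of_real q / ?z"
  proof -
    have "(\<Sum>k\<in>J. inverse (?z - Z k)) = (\<Sum>w\<in>{w. w ^ n = - of_real (R ^ n) * c}. inverse (?z - w))"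
      by (rule sum.reindex_bij_betw[OF ZJ])
    also have "\<dots> = of_nat n * ?z ^ (n - 1) / (?z ^ n - (- of_real (R ^ n) * c))"
    proof (rule sum_inverse_diff_roots_other[OF _ _ n])
      have "?z ^ n - (- of_real (R ^ n) * c) \<noteq> 0"
        using sum_pos c unfolding diff by (metis less_irrefl mult_eq_0_iff of_real_eq_0_iff)
      then show "?z ^ n \<noteq> - of_real (R ^ n) * c" by (metis right_minus_eq)
    qed (use c rR in auto)
    \<comment> \<open>Writing \<open>z ^ (n - 1)\<close> as \<open>z ^ n / z\<close> exposes the
      factor \<open>c\<close>, which then cancels.\<close>
    also have "\<dots> = of_nat n * (?z ^ n / ?z) / (of_real (r ^ n + R ^ n) * c)"
      using z n unfolding diff by (cases n) auto
    also have "\<dots> = of_real q / ?z"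
      unfolding zn using c by (simp add: q_def)
    finally show ?thesis .
  qed
  have "(\<Sum>k\<in>{1..N} - {j}. of_real (m k) * inverse (?z - Z k))
      = (\<Sum>k\<in>I - {j}. of_real (m k) * inverse (?z - Z k)) + (\<Sum>k\<in>J. of_real (m k) * inverse (?z - Z k))"
  proof -
    have "{1..N} - {j} = (I - {j}) \<union> J" using IJ j by auto
    then show ?thesis using fin IJ by (simp add: sum.union_disjoint Diff_Int_distrib2)
  qed
  also have "\<dots> = of_real \<mu> * ((of_nat n - 1) / (2 * ?z))
      - of_real \<mu> * (of_real q / ?z)"
    unfolding inner[symmetric] outer[symmetric] sum_distrib_left using m
    by (simp add: sum_negf)
  also have "\<dots> = of_real (\<mu> * ((real n - 1) / 2 - q)) * inverse ?z"
    by (simp add: field_simps z)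
  finally have S: "(\<Sum>k\<in>{1..N} - {j}. of_real (m k) * inverse (?z - Z k)) = \<dots>" .
  have "cnj (inverse ?z) = of_real (1 / r) * cis \<psi>"
    using j(2) by (simp add: cis_cnj flip: cis_inverse) (simp add: divide_inverse)
  then have "of_real (2 * m j) * cnj (\<Sum>k\<in>{1..N} - {j}. of_real (m k) * inverse (?z - Z k))
      = of_real (2 * \<mu> * (\<mu> * ((real n - 1) / 2 - q)) * (1 / r)) * cis \<psi>"
    unfolding S complex_cnj_mult complex_cnj_complex_of_real m(1)[OF j(1)] of_real_mult
    by (simp only: mult_ac)
  \<comment> \<open>Only the square of the vortex strength enters, so both signs of \<mu> give the
    same motion.\<close>
  also have "2 * \<mu> * (\<mu> * ((real n - 1) / 2 - q)) * (1 / r) = \<mu>\<^sup>2 * ((real n - 1 - 2 * q) / r)"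
    using rR by (simp add: power2_eq_square field_simps)
  finally have V: "of_real (2 * m j) * cnj (\<Sum>k\<in>{1..N} - {j}. of_real (m k) * inverse (?z - Z k))
      = of_real (\<mu>\<^sup>2 * ((real n - 1 - 2 * q) / r)) * cis \<psi>" .
  show ?thesis
    unfolding vortex_velocity_complex_vec V complex_vec_rcis \<mu> mult_1 q_def
    by (simp only: mult.assoc times_divide_eq_right)
qed

section \<open>Evolution of the two radii\<close>

text \<open>With \<open>\<rho>\<^sub>1 + \<rho>\<^sub>2 = A - 4 t\<close>, the ratio \<open>q\<close> of the two radii satisfies an autonomous
  equation in the rescaled time \<open>- ln (1 - 4 t / A) / 4\<close>, in which \<open>q = 1\<close> is an equilibrium
  reached only asymptotically.\<close>
lemma ring_radii_exist:
  fixes n :: nat and a1 a2 :: real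
  assumes n: "n \<ge> 2" and a: "0 < a1" "a1 < a2"
  obtains \<rho>1 \<rho>2 :: "real \<Rightarrow> real" where "\<rho>1 0 = a1\<^sup>2" "\<rho>2 0 = a2\<^sup>2"
    and "\<And>t. 0 \<le> t \<Longrightarrow> t < (a1\<^sup>2 + a2\<^sup>2) / 4 \<Longrightarrow> 0 < \<rho>1 t"
    and "\<And>t. 0 \<le> t \<Longrightarrow> t < (a1\<^sup>2 + a2\<^sup>2) / 4 \<Longrightarrow> 0 < \<rho>2 t"
    and "\<And>t. 0 \<le> t \<Longrightarrow> t < (a1\<^sup>2 + a2\<^sup>2) / 4 \<Longrightarrow> \<rho>1 t + \<rho>2 t = a1\<^sup>2 + a2\<^sup>2 - 4 * t"
    and "\<And>t. 0 \<le> t \<Longrightarrow> t < (a1\<^sup>2 + a2\<^sup>2) / 4 \<Longrightarrow> (\<rho>1 has_real_derivative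
           2 * (real n - 1 - 2 * real n * sqrt (\<rho>1 t) ^ n / (sqrt (\<rho>1 t) ^ n + sqrt (\<rho>2 t) ^ n))) (at t)"
    and "\<And>t. 0 \<le> t \<Longrightarrow> t < (a1\<^sup>2 + a2\<^sup>2) / 4 \<Longrightarrow> (\<rho>2 has_real_derivative
           2 * (real n - 1 - 2 * real n * sqrt (\<rho>2 t) ^ n / (sqrt (\<rho>2 t) ^ n + sqrt (\<rho>1 t) ^ n))) (at t)"
proof -
  define A where "A = a1\<^sup>2 + a2\<^sup>2"
  have A: "A > 0" using a by (simp add: A_def add_pos_pos)
  define q0 where "q0 = a1 / a2"
  have q0: "0 < q0" "q0 < 1" using a by (auto simp: q0_def)
  \<comment> \<open>For the ratio \<open>q\<close> of the radii, \<open>g q\<close> is half of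
    \<open>\<rho>1' - q^2 * \<rho>2'\<close>, the numerator in the derivative of
    \<open>\<rho>1 / \<rho>2 = q^2\<close>. Dividing by
    \<open>\<rho>2 = (A - 4 * t) / (1 + q^2)\<close> gives
    \<open>q' = f q / (A - 4 * t)\<close>.\<close>
  define g where "g q = (real n - 1) * (1 - q\<^sup>2) + 2 * real n * (q\<^sup>2 - q ^ n) / (1 + q ^ n)" for q :: real
  define f where "f q = (1 + q\<^sup>2) / q * g q" for q :: real
  have g_pos: "0 < g q" if "0 < q" "q < 1" for q
  proof -
    \<comment> \<open>Here \<open>n \<ge> 2\<close> enters: it makes the second summand of
      \<open>g\<close> nonnegative.\<close>
    have "q ^ n \<le> q\<^sup>2" using power_decreasing[OF n, of q] that by simp
    moreover have "q\<^sup>2 < 1" using that by (simp add: power_less_one_iff)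
    ultimately show ?thesis
      unfolding g_def using n that by (intro add_pos_nonneg) (auto intro!: mult_pos_pos divide_nonneg_pos add_pos_pos)
  qed
  \<comment> \<open>Both summands of \<open>g\<close> vanish at \<open>q = 1\<close> at least
    linearly, the second by Bernoulli's inequality. This is the decay that keeps \<open>q\<close>
    below \<open>1\<close> for all rescaled times.\<close>
  have g_le: "g q \<le> (2 * real n + 2 * real n * real n) * (1 - q)" if "0 < q" "q < 1" for q
  proof -
    have q2: "1 - q\<^sup>2 = (1 + q) * (1 - q)" by (simp add: power2_eq_square algebra_simps)
    have "(real n - 1) * (1 - q\<^sup>2) \<le> real n * (2 * (1 - q))"
      unfolding q2 using n that by (intro mult_mono) auto
    moreover have "1 - q ^ n \<le> real n * (1 - q)"
      using Bernoulli_inequality[of "q - 1" n] that by (simp add: algebra_simps)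
    then have qn: "q\<^sup>2 - q ^ n \<le> real n * (1 - q)"
      using that power_le_one[of q 2] by linarith
    have "2 * real n * (q\<^sup>2 - q ^ n) / (1 + q ^ n) \<le> 2 * real n * (q\<^sup>2 - q ^ n) / 1"
      using power_decreasing[OF n, of q] that
      by (intro divide_left_mono) (auto intro: add_pos_pos)
    then have "2 * real n * (q\<^sup>2 - q ^ n) / (1 + q ^ n) \<le> 2 * real n * (real n * (1 - q))"
      using mult_left_mono[OF qn, of "2 * real n"] by simp
    ultimately show ?thesis unfolding g_def by (simp add: algebra_simps)
  qed
  obtain u where u0: "u 0 = q0" and u: "\<And>s. 0 \<le> s \<Longrightarrow> 0 < u s \<and> u s < 1"
    and du: "\<And>s. 0 \<le> s \<Longrightarrow> (u has_real_derivative f (u s)) (at s)"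
  \<comment> \<open>The factor \<open>2 / q0\<close> bounds \<open>(1 + q^2) / q\<close> on
    \<open>{q0..<1}\<close>; the other factor is the constant of \<open>g_le\<close>.\<close>
  proof (rule autonomous_ode_exists[of 0 1 f q0 "2 / q0 * (2 * real n + 2 * real n * real n)"])
    have "1 + q ^ n \<noteq> 0" if "0 < q" for q :: real
      using zero_less_power[OF that, of n] by linarith
    then show "continuous_on {0<..<1} f"
      unfolding f_def g_def by (intro continuous_intros) auto
    show "0 < f q" if "0 < q" "q < 1" for q
      using g_pos[OF that] that by (auto simp: f_def intro!: mult_pos_pos divide_pos_pos add_pos_pos)
    show "f q \<le> 2 / q0 * (2 * real n + 2 * real n * real n) * (1 - q)" if "q0 \<le> q" "q < 1" for q
    proof -
      have "q\<^sup>2 \<le> 1" using that q0 by (intro power_le_one) auto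
      then have "(1 + q\<^sup>2) / q \<le> 2 / q0"
        using that q0 by (intro frac_le) auto
      then show ?thesis
        unfolding f_def mult.assoc[of "2 / q0"] using g_le[of q] g_pos[of q] that q0
        by (intro mult_mono) auto
    qed
  qed (use q0 in auto)
  define q where "q t = u (- ln (1 - 4 * t / A) / 4)" for t
  \<comment> \<open>The known total \<open>A - 4 * t\<close> is split in the proportion
    \<open>q^2 : 1\<close>.\<close>
  define \<rho>1 where "\<rho>1 t = (A - 4 * t) * ((q t)\<^sup>2 / (1 + (q t)\<^sup>2))" for t
  define \<rho>2 where "\<rho>2 t = (A - 4 * t) * (1 / (1 + (q t)\<^sup>2))" for t
  have sq: "1 + x\<^sup>2 > 0" for x :: real by (simp add: add_pos_nonneg)
  have main: "0 < \<rho>1 t \<and> 0 < \<rho>2 t \<and> \<rho>1 t + \<rho>2 t = A - 4 * t \<and>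
      (\<rho>1 has_real_derivative
        2 * (real n - 1 - 2 * real n * sqrt (\<rho>1 t) ^ n / (sqrt (\<rho>1 t) ^ n + sqrt (\<rho>2 t) ^ n))) (at t) \<and>
      (\<rho>2 has_real_derivative
        2 * (real n - 1 - 2 * real n * sqrt (\<rho>2 t) ^ n / (sqrt (\<rho>2 t) ^ n + sqrt (\<rho>1 t) ^ n))) (at t)"
    if t: "0 \<le> t" "t < A / 4" for t
  proof -
    have s: "0 < A - 4 * t" using t by simp
    have "1 - 4 * t / A > 0" "1 - 4 * t / A \<le> 1" using t A by (auto simp: field_simps)
    then have \<tau>: "0 \<le> - ln (1 - 4 * t / A) / 4" by simp
    have q: "0 < q t" "q t < 1" using u[OF \<tau>] by (auto simp: q_def)
    define Q where "Q = q t ^ n"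
    have Q: "0 < Q" using q by (simp add: Q_def)
    \<comment> \<open>The rescaled time has derivative \<open>1 / (A - 4 * t)\<close>, exactly the
      factor that separates the equation for \<open>q\<close> from an autonomous one.\<close>
    have d\<tau>: "((\<lambda>t. - ln (1 - 4 * t / A) / 4) has_real_derivative 1 / (A - 4 * t)) (at t)"
      using \<open>1 - 4 * t / A > 0\<close> A s by (auto intro!: derivative_eq_intros simp: field_simps)
    define w where "w = f (q t) / (A - 4 * t)"
    from DERIV_chain2[OF du[OF \<tau>] d\<tau>] have dq: "(q has_real_derivative w) (at t)"
      by (simp add: q_def[abs_def] w_def)
    have pos: "0 < \<rho>1 t" "0 < \<rho>2 t"
      unfolding \<rho>1_def \<rho>2_def using s q by (auto intro!: mult_pos_pos divide_pos_pos sq)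
    have sum: "\<rho>1 t + \<rho>2 t = A - 4 * t"
    proof -
      have "(q t)\<^sup>2 / (1 + (q t)\<^sup>2) + 1 / (1 + (q t)\<^sup>2) = 1"
        using sq[of "q t"] by (simp add: field_simps)
      then show ?thesis unfolding \<rho>1_def \<rho>2_def distrib_left[symmetric] by simp
    qed
    have "\<rho>1 t = (q t)\<^sup>2 * \<rho>2 t" by (simp add: \<rho>1_def \<rho>2_def)
    then have "sqrt (\<rho>1 t) = q t * sqrt (\<rho>2 t)" using q by (simp add: real_sqrt_mult)
    then have pw: "sqrt (\<rho>1 t) ^ n = Q * sqrt (\<rho>2 t) ^ n" by (simp add: Q_def power_mult_distrib)
    \<comment> \<open>Both fractions are homogeneous in the radii, so the common power of
      \<open>sqrt (\<rho>2 t)\<close> cancels and only \<open>Q\<close> remains.\<close>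
    have ratio: "2 * real n * sqrt (\<rho>1 t) ^ n / (sqrt (\<rho>1 t) ^ n + sqrt (\<rho>2 t) ^ n) = 2 * real n * Q / (1 + Q)"
      "2 * real n * sqrt (\<rho>2 t) ^ n / (sqrt (\<rho>2 t) ^ n + sqrt (\<rho>1 t) ^ n) = 2 * real n / (1 + Q)"
    proof -
      have "Q * P + P = (1 + Q) * P" "P + Q * P = (1 + Q) * P" for P by (simp_all add: algebra_simps)
      then show "2 * real n * sqrt (\<rho>1 t) ^ n / (sqrt (\<rho>1 t) ^ n + sqrt (\<rho>2 t) ^ n) = 2 * real n * Q / (1 + Q)"
        "2 * real n * sqrt (\<rho>2 t) ^ n / (sqrt (\<rho>2 t) ^ n + sqrt (\<rho>1 t) ^ n) = 2 * real n / (1 + Q)"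
        using pos Q by (simp_all only: pw) simp_all
    qed
    \<comment> \<open>\<open>?h\<close> is the derivative of the first ring's share of the total.
      The two shares add up to \<open>1\<close>, so the second one has derivative
      \<open>- ?h\<close>.\<close>
    let ?h = "2 * q t * w / (1 + (q t)\<^sup>2)\<^sup>2"
    have h: "(A - 4 * t) * ?h = 2 * g (q t) / (1 + (q t)\<^sup>2)"
      using s q sq[of "q t"] by (simp add: w_def f_def power2_eq_square divide_simps)
    have g: "g (q t) = (real n - 1) * (1 - (q t)\<^sup>2) + 2 * real n * ((q t)\<^sup>2 - Q) / (1 + Q)"
      by (simp add: g_def Q_def)
    have d1: "((\<lambda>t. (q t)\<^sup>2 / (1 + (q t)\<^sup>2)) has_real_derivative ?h) (at t)"
      using sq[of "q t"]
      by (auto intro!: derivative_eq_intros dq simp: power2_eq_square divide_simps) (simp_all add: algebra_simps)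
    have d2: "((\<lambda>t. 1 / (1 + (q t)\<^sup>2)) has_real_derivative - ?h) (at t)"
      using sq[of "q t"]
      by (auto intro!: derivative_eq_intros dq simp: power2_eq_square divide_simps)
    have "(\<rho>1 has_real_derivative - 4 * ((q t)\<^sup>2 / (1 + (q t)\<^sup>2)) + (A - 4 * t) * ?h) (at t)"
      unfolding \<rho>1_def[abs_def]
      by (rule DERIV_cong[OF DERIV_mult[OF _ d1]]) (auto intro!: derivative_eq_intros)
    moreover have "- 4 * ((q t)\<^sup>2 / (1 + (q t)\<^sup>2)) + (A - 4 * t) * ?h
        = 2 * (real n - 1 - 2 * real n * Q / (1 + Q))"
      unfolding h g using sq[of "q t"] Q by (simp add: divide_simps) (simp add: algebra_simps)
    moreover have "(\<rho>2 has_real_derivative - 4 * (1 / (1 + (q t)\<^sup>2)) + (A - 4 * t) * - ?h) (at t)"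
      unfolding \<rho>2_def[abs_def]
      by (rule DERIV_cong[OF DERIV_mult[OF _ d2]]) (auto intro!: derivative_eq_intros)
    moreover have "- 4 * (1 / (1 + (q t)\<^sup>2)) + (A - 4 * t) * - ?h
        = 2 * (real n - 1 - 2 * real n / (1 + Q))"
      unfolding mult_minus_right h g using sq[of "q t"] Q by (simp add: divide_simps) (simp add: algebra_simps)
    ultimately show ?thesis using pos sum by (simp only: ratio)
  qed
  have "q 0 = q0" by (simp add: q_def u0)
  have "1 + (a1 / a2)\<^sup>2 = A / a2\<^sup>2" using a by (simp add: A_def field_simps)
  then have "\<rho>1 0 = a1\<^sup>2" "\<rho>2 0 = a2\<^sup>2"
    using a A by (simp_all add: \<rho>1_def \<rho>2_def \<open>q 0 = q0\<close> q0_def power_divide)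
  then show thesis using main that unfolding A_def by blast
qed

section \<open>Total collision\<close>

text \<open>Passes from squared radii to positions; the factor \<open>2\<close> cancels the one from
  the derivative of the square root, leaving the form of \<open>two_ring_velocity\<close>.\<close>

lemma has_vector_derivative_sqrt_scaleR:
  fixes v :: "'a::real_normed_vector"
  assumes "(r has_real_derivative 2 * d) (at t)" "0 < r t"
  shows "((\<lambda>t. sqrt (r t) *\<^sub>R v) has_vector_derivative (d / sqrt (r t)) *\<^sub>R v) (at t within A)"
proof -
  have "((\<lambda>t. sqrt (r t)) has_real_derivative inverse (sqrt (r t)) / 2 * (2 * d)) (at t)"
    by (rule DERIV_chain2[where f = sqrt, OF DERIV_real_sqrt[OF assms(2)] assms(1)])
  then have "((\<lambda>t. sqrt (r t)) has_real_derivative d / sqrt (r t)) (at t)"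
    by (simp add: inverse_eq_divide)
  from has_vector_derivative_scaleR[OF this has_vector_derivative_const, of v]
  have "((\<lambda>t. sqrt (r t) *\<^sub>R v) has_vector_derivative (d / sqrt (r t)) *\<^sub>R v) (at t)"
    by simp
  then show ?thesis by (rule has_vector_derivative_at_within)
qed

text \<open>A solution living beyond \<open>T\<close> would agree with \<open>x\<close> before
  \<open>T\<close> by uniqueness, hence by continuity place vortices \<open>1\<close> and
  \<open>2\<close> at the same point \<open>p\<close> at time \<open>T\<close>, where its positions
  must be distinct.\<close>

lemma vortex_solution_tendsto_maximal:
  assumes x: "vortex_solution N m p0 T x" and y: "vortex_solution N m p0 S y" and "N \<ge> 2"
    and lim: "\<And>j. j \<in> {1..N} \<Longrightarrow> (x j \<longlongrightarrow> p) (at_left T)"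
  shows "S \<le> T"
proof (rule ccontr)
  assume "\<not> S \<le> T"
  have T: "0 < T" using x by (simp add: vortex_solution_def)
  have "y j T = p" if j: "j \<in> {1..N}" for j
  proof -
    have "continuous_on {0..T} (y j)"
      by (rule continuous_on_subset[OF vortex_solution_continuous_on[OF y j]]) (use \<open>\<not> S \<le> T\<close> in auto)
    then have "(y j \<longlongrightarrow> y j T) (at_left T)"
      using T by (simp add: continuous_on_Icc_at_leftD)
    moreover have "eventually (\<lambda>t. y j t = x j t) (at_left T)"
      using eventually_at_left_real[OF T]
      by eventually_elim (use vortex_solution_unique[OF x y _ _ _ j] \<open>\<not> S \<le> T\<close> in auto)
    ultimately have "(x j \<longlongrightarrow> y j T) (at_left T)"
      by (rule Lim_transform_eventually)
    then show ?thesis using lim[OF j] by (rule tendsto_unique[OF trivial_limit_at_left_real])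
  qed
  then have "y 1 T = y 2 T" using \<open>N \<ge> 2\<close> by simp
  moreover have "y 1 T \<noteq> y 2 T"
    using y T \<open>\<not> S \<le> T\<close> \<open>N \<ge> 2\<close> unfolding vortex_solution_def by force
  ultimately show False by contradiction
qed

lemma vortex_solution_collision_cluster:
  assumes x: "vortex_solution N m p0 T x" and "N \<ge> 2"
    and lim: "\<And>j. j \<in> {1..N} \<Longrightarrow> (x j \<longlongrightarrow> p) (at_left T)"
  shows "collision_cluster N x"
proof -
  have "0 < Min {norm (x j t - x l t) |j l. 1 \<le> j \<and> j < l \<and> l \<le> N}" if t: "t \<in> {0..<T}" for t
  proof -
    let ?S = "{norm (x j t - x l t) |j l. 1 \<le> j \<and> j < l \<and> l \<le> N}"
    \<comment> \<open>The set is finite, and nonempty because \<open>N \<ge> 2\<close>, so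
      \<open>Min\<close> is a genuine minimum.\<close>
    have "?S \<subseteq> (\<lambda>(j, l). norm (x j t - x l t)) ` ({1..N} \<times> {1..N})" by force
    then have "finite ?S" by (rule finite_subset) simp
    moreover have "norm (x 1 t - x 2 t) \<in> ?S" using \<open>N \<ge> 2\<close> by force
    moreover have "0 < d" if "d \<in> ?S" for d
      using that x t unfolding vortex_solution_def by force
    ultimately show ?thesis by (subst Min_gr_iff) auto
  qed
  then show ?thesis
    using x lim unfolding collision_cluster_def vortex_solution_def by blast
qed

theorem proposition4p3:
  fixes n N :: nat and m :: "nat \<Rightarrow> real" and m0 \<theta>0 a1 a2 Tc :: real
    and \<theta> \<alpha> :: "nat \<Rightarrow> real" and p0 :: "nat \<Rightarrow> real^2"
  assumes "n \<ge> 2" and "N = 2 * n"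
    and "m0 \<in> {1, -1}"
    and "\<And>j. j \<in> {1..n} \<Longrightarrow> m j = m0"
    and "\<And>j. j \<in> {1..n} \<Longrightarrow> m (n + j) = - m0"
    and "0 \<le> \<theta>0" and "\<theta>0 < 2 * pi"
    and "0 < a1" and "a1 < a2"
    and "\<And>j. j \<in> {1..n} \<Longrightarrow> \<theta> j = 2 * (real j - 1) * pi / real n + \<theta>0"
    and "\<And>j. j \<in> {1..n} \<Longrightarrow> \<alpha> j = 2 * (real j - 1) * pi / real n + pi / real n + \<theta>0"
    and "\<And>j. j \<in> {1..n} \<Longrightarrow> p0 j = a1 *\<^sub>R unit_vec (\<theta> j)"
    and "\<And>j. j \<in> {1..n} \<Longrightarrow> p0 (n + j) = a2 *\<^sub>R unit_vec (\<alpha> j)"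
    and "Tc = (a1\<^sup>2 + a2\<^sup>2) / 4"
  shows "\<exists>x. unique_maximal_vortex_solution N m p0 Tc x \<and>
           (\<exists>\<rho>1 \<rho>2 :: real \<Rightarrow> real.
              (\<forall>j\<in>{1..n}. \<forall>t\<in>{0..<Tc}.
                 x j t = sqrt (\<rho>1 t) *\<^sub>R unit_vec (\<theta> j) \<and>
                 x (n + j) t = sqrt (\<rho>2 t) *\<^sub>R unit_vec (\<alpha> j)) \<and>
              (\<forall>t\<in>{0..<Tc}. \<rho>1 t > 0 \<and> \<rho>2 t > 0) \<and>
              (\<rho>1 \<longlongrightarrow> 0) (at_left Tc) \<and> (\<rho>2 \<longlongrightarrow> 0) (at_left Tc)) \<and>
           collision_cluster N x"
proof -
  have n: "n > 0" using assms(1) by simp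
  have Tc: "0 < Tc" unfolding assms(14) using assms(8,9) by (simp add: add_pos_pos)
  obtain \<rho>1 \<rho>2 :: "real \<Rightarrow> real" where \<rho>0: "\<rho>1 0 = a1\<^sup>2" "\<rho>2 0 = a2\<^sup>2"
    and pos: "\<And>t. 0 \<le> t \<Longrightarrow> t < Tc \<Longrightarrow> 0 < \<rho>1 t" "\<And>t. 0 \<le> t \<Longrightarrow> t < Tc \<Longrightarrow> 0 < \<rho>2 t"
    and sum: "\<And>t. 0 \<le> t \<Longrightarrow> t < Tc \<Longrightarrow> \<rho>1 t + \<rho>2 t = a1\<^sup>2 + a2\<^sup>2 - 4 * t"
    and d\<rho>: "\<And>t. 0 \<le> t \<Longrightarrow> t < Tc \<Longrightarrow> (\<rho>1 has_real_derivative
           2 * (real n - 1 - 2 * real n * sqrt (\<rho>1 t) ^ n / (sqrt (\<rho>1 t) ^ n + sqrt (\<rho>2 t) ^ n))) (at t)"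
      "\<And>t. 0 \<le> t \<Longrightarrow> t < Tc \<Longrightarrow> (\<rho>2 has_real_derivative
           2 * (real n - 1 - 2 * real n * sqrt (\<rho>2 t) ^ n / (sqrt (\<rho>2 t) ^ n + sqrt (\<rho>1 t) ^ n))) (at t)"
    using ring_radii_exist[OF assms(1,8,9)] unfolding assms(14) by blast
  define \<rho> where "\<rho> k = (if k \<le> n then \<rho>1 else \<rho>2)" for k
  define \<phi> where "\<phi> k = (if k \<le> n then \<theta> k else \<alpha> (k - n))" for k
  define x where "x k t = sqrt (\<rho> k t) *\<^sub>R unit_vec (\<phi> k)" for k t
  define Z where "Z t k = of_real (sqrt (\<rho> k t)) * cis (\<phi> k)" for t k
  have xZ: "x k t = complex_vec (Z t k)" for k t
    by (simp add: x_def Z_def complex_vec_rcis)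
  define I where "I = {1..n}"
  define J where "J = {n + 1..2 * n}"
  have IJ: "{1..N} = I \<union> J" "I \<inter> J = {}" using assms(2) by (auto simp: I_def J_def)
  \<comment> \<open>The common phase of the \<open>n\<close>-th powers: it is shared by both rings
    up to sign.\<close>
  define c where "c = cis (real n * \<theta>0)"
  have c: "c \<noteq> 0" by (simp add: c_def)
  have ZI: "bij_betw (Z t) I {w. w ^ n = of_real (sqrt (\<rho>1 t) ^ n) * c}" if "0 \<le> t" "t < Tc" for t
  proof -
    let ?s = "of_real (sqrt (\<rho>1 t)) * cis \<theta>0"
    have s_power: "?s ^ n = of_real (sqrt (\<rho>1 t) ^ n) * c"
      by (simp add: power_mult_distrib Complex.DeMoivre c_def)
    have "bij_betw (\<lambda>j. ?s * cis (2 * (real j - 1) * pi / real n)) I {w. w ^ n = ?s ^ n}"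
      unfolding I_def using pos(1)[OF that] n by (intro bij_betw_regular_polygon) auto
    then show ?thesis
      unfolding s_power
    proof (rule bij_betw_cong[THEN iffD1, rotated])
      fix j assume "j \<in> I"
      then show "?s * cis (2 * (real j - 1) * pi / real n) = Z t j"
        using assms(10)[of j] by (simp add: Z_def \<rho>_def \<phi>_def I_def cis_mult add.commute)
    qed
  qed
  have ZJ: "bij_betw (Z t) J {w. w ^ n = - of_real (sqrt (\<rho>2 t) ^ n) * c}" if "0 \<le> t" "t < Tc" for t
  proof -
    let ?s = "of_real (sqrt (\<rho>2 t)) * cis (pi / real n + \<theta>0)"
    \<comment> \<open>The half-step rotation by \<open>pi / n\<close> contributes
      \<open>cis pi = - 1\<close>, the source of the opposite sign for the outer ring.\<close>
    have "cis (pi / real n + \<theta>0) ^ n = cis (pi + real n * \<theta>0)"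
      using n by (simp add: Complex.DeMoivre distrib_left)
    then have s_power: "?s ^ n = - of_real (sqrt (\<rho>2 t) ^ n) * c"
      by (simp add: power_mult_distrib c_def flip: cis_mult)
    have "bij_betw (\<lambda>k. k - n) J {1..n}"
      by (rule bij_betw_byWitness[where f' = "\<lambda>j. j + n"]) (auto simp: J_def)
    moreover have "bij_betw (\<lambda>j. ?s * cis (2 * (real j - 1) * pi / real n)) {1..n} {w. w ^ n = ?s ^ n}"
      using pos(2)[OF that] n by (intro bij_betw_regular_polygon) auto
    ultimately have "bij_betw ((\<lambda>j. ?s * cis (2 * (real j - 1) * pi / real n)) \<circ> (\<lambda>k. k - n)) J {w. w ^ n = ?s ^ n}"
      by (rule bij_betw_trans)
    then show ?thesis
      unfolding s_power
    proof (rule bij_betw_cong[THEN iffD1, rotated])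
      fix k assume "k \<in> J"
      moreover from this have "\<alpha> (k - n) = 2 * (real (k - n) - 1) * pi / real n + pi / real n + \<theta>0"
        by (intro assms(11)) (auto simp: J_def)
      ultimately show "((\<lambda>j. ?s * cis (2 * (real j - 1) * pi / real n)) \<circ> (\<lambda>k. k - n)) k = Z t k"
        by (simp add: Z_def \<rho>_def \<phi>_def J_def cis_mult mult.assoc add_ac)
    qed
  qed
  have mI: "m k = m0" if "k \<in> I" for k using that assms(4) by (simp add: I_def)
  have mJ: "m k = - m0" if "k \<in> J" for k
  proof -
    have "k - n \<in> {1..n}" "n + (k - n) = k" using that by (auto simp: J_def)
    then show ?thesis using assms(5)[of "k - n"] by simp
  qed
  have m0: "m0\<^sup>2 = 1" "(- m0)\<^sup>2 = 1" using assms(3) by auto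
  have inj: "inj_on (Z t) {1..N}" if t: "0 \<le> t" "t < Tc" for t
  proof -
    \<comment> \<open>Within a ring the vertices are distinct. The two rings are disjoint because
      their \<open>n\<close>-th powers lie on opposite rays from the origin.\<close>
    have "Z t ` I \<inter> Z t ` J = {}"
    proof -
      have "0 < sqrt (\<rho>1 t) ^ n + sqrt (\<rho>2 t) ^ n"
        using pos[OF t] by (intro add_pos_pos) auto
      then have "of_real (sqrt (\<rho>1 t) ^ n) * c - (- of_real (sqrt (\<rho>2 t) ^ n) * c) \<noteq> 0"
        using c unfolding minus_mult_left[symmetric] diff_minus_eq_add distrib_right[symmetric] of_real_add[symmetric]
        by (metis less_irrefl mult_eq_0_iff of_real_eq_0_iff)
      then have "of_real (sqrt (\<rho>1 t) ^ n) * c \<noteq> - of_real (sqrt (\<rho>2 t) ^ n) * c"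
        by (metis right_minus_eq)
      moreover have "Z t ` I = {w. w ^ n = of_real (sqrt (\<rho>1 t) ^ n) * c}"
        "Z t ` J = {w. w ^ n = - of_real (sqrt (\<rho>2 t) ^ n) * c}"
        using ZI[OF t] ZJ[OF t] by (simp_all only: bij_betw_def)
      ultimately show ?thesis by force
    qed
    then show ?thesis
      using ZI[OF t] ZJ[OF t] unfolding IJ(1) bij_betw_def by (intro inj_on_Un[THEN iffD2]) blast
  qed
  have sol: "vortex_solution N m p0 Tc x"
    unfolding vortex_solution_def
  proof (intro conjI ballI impI Tc)
    fix j assume "j \<in> {1..N}"
    show "x j 0 = p0 j"
    proof (cases "j \<le> n")
      case True
      then show ?thesis
        using assms(8) assms(12)[of j] \<open>j \<in> {1..N}\<close> by (simp add: x_def \<rho>_def \<phi>_def \<rho>0)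
    next
      case False
      then have "j - n \<in> {1..n}" "n + (j - n) = j" using \<open>j \<in> {1..N}\<close> assms(2) by auto
      then show ?thesis
        using assms(8,9) assms(13)[of "j - n"] False by (simp add: x_def \<rho>_def \<phi>_def \<rho>0)
    qed
  next
    fix t j k assume "t \<in> {0..<Tc}" "j \<in> {1..N}" "k \<in> {1..N}" "j \<noteq> k"
    then show "x j t \<noteq> x k t"
      using inj[of t] by (simp add: xZ complex_vec_eq_iff inj_on_eq_iff)
  next
    fix t j assume "t \<in> {0..<Tc}" and j: "j \<in> {1..N}"
    then have t: "0 \<le> t" "t < Tc" by auto
    have r: "0 < sqrt (\<rho>1 t)" "0 < sqrt (\<rho>2 t)" using pos[OF t] by auto
    show "(x j has_vector_derivative vortex_velocity N m (\<lambda>k. x k t) j) (at t within {0..<Tc})"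
    proof (cases "j \<in> I")
      case True
      then have j': "Z t j = of_real (sqrt (\<rho>1 t)) * cis (\<phi> j)" by (simp add: Z_def \<rho>_def I_def)
      have "x j = (\<lambda>t. sqrt (\<rho>1 t) *\<^sub>R unit_vec (\<phi> j))"
        using True by (simp add: x_def[abs_def] \<rho>_def I_def)
      moreover note two_ring_velocity[OF n r c m0(1) IJ mI mJ ZI[OF t] ZJ[OF t] True j']
      ultimately show ?thesis
        using has_vector_derivative_sqrt_scaleR[OF d\<rho>(1)[OF t] pos(1)[OF t]] by (simp only: xZ[symmetric])
    next
      case False
      then have J: "j \<in> J" using j IJ by auto
      then have j': "Z t j = of_real (sqrt (\<rho>2 t)) * cis (\<phi> j)" by (simp add: Z_def \<rho>_def J_def)
      have "vortex_velocity N m (\<lambda>k. complex_vec (Z t k)) j = ((real n - 1 - 2 * real n * sqrt (\<rho>2 t) ^ n /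
          (sqrt (\<rho>2 t) ^ n + sqrt (\<rho>1 t) ^ n)) / sqrt (\<rho>2 t)) *\<^sub>R unit_vec (\<phi> j)"
      \<comment> \<open>The outer ring is treated by exchanging the roles of the rings, which
        reverses the signs of both the strength and \<open>c\<close>.\<close>
      proof (rule two_ring_velocity[where I = J and J = I and \<mu> = "- m0" and c = "- c"])
        show "bij_betw (Z t) J {w. w ^ n = of_real (sqrt (\<rho>2 t) ^ n) * - c}"
          "bij_betw (Z t) I {w. w ^ n = - of_real (sqrt (\<rho>1 t) ^ n) * - c}"
          using ZI[OF t] ZJ[OF t] by simp_all
      qed (use n r c m0 mI mJ IJ J j' in auto)
      moreover have "x j = (\<lambda>t. sqrt (\<rho>2 t) *\<^sub>R unit_vec (\<phi> j))"
        using J by (simp add: x_def[abs_def] \<rho>_def J_def)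
      ultimately show ?thesis
        using has_vector_derivative_sqrt_scaleR[OF d\<rho>(2)[OF t] pos(2)[OF t]] by (simp only: xZ[symmetric])
    qed
  qed
  have "((\<lambda>t. a1\<^sup>2 + a2\<^sup>2 - 4 * t) \<longlongrightarrow> a1\<^sup>2 + a2\<^sup>2 - 4 * Tc) (at_left Tc)"
    by (intro tendsto_intros)
  moreover have "a1\<^sup>2 + a2\<^sup>2 - 4 * Tc = 0" unfolding assms(14) by simp
  ultimately have lim_sum: "((\<lambda>t. a1\<^sup>2 + a2\<^sup>2 - 4 * t) \<longlongrightarrow> 0) (at_left Tc)"
    by simp
  \<comment> \<open>Both squared radii are positive with sum tending to zero, so each is squeezed to
    zero.\<close>
  have ev: "eventually (\<lambda>t. 0 \<le> \<rho>1 t \<and> 0 \<le> \<rho>2 t \<and> \<rho>1 t \<le> a1\<^sup>2 + a2\<^sup>2 - 4 * t \<and> \<rho>2 t \<le> a1\<^sup>2 + a2\<^sup>2 - 4 * t) (at_left Tc)"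
    using eventually_at_left_real[OF Tc]
  proof eventually_elim
    case (elim t)
    then show ?case using pos[of t] sum[of t] by auto
  qed
  have lim: "(\<rho>1 \<longlongrightarrow> 0) (at_left Tc)" "(\<rho>2 \<longlongrightarrow> 0) (at_left Tc)"
    by (rule tendsto_sandwich[OF _ _ tendsto_const lim_sum]; rule eventually_mono[OF ev]; simp)+
  have xlim: "(x j \<longlongrightarrow> 0) (at_left Tc)" for j
  proof -
    have "(\<rho> j \<longlongrightarrow> 0) (at_left Tc)" using lim by (simp add: \<rho>_def)
    then have "((\<lambda>t. sqrt (\<rho> j t) *\<^sub>R unit_vec (\<phi> j)) \<longlongrightarrow> sqrt 0 *\<^sub>R unit_vec (\<phi> j)) (at_left Tc)"
      by (intro tendsto_intros)
    then show ?thesis by (simp add: x_def[abs_def])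
  qed
  have N: "N \<ge> 2" using assms(1,2) by simp
  have "unique_maximal_vortex_solution N m p0 Tc x"
    unfolding unique_maximal_vortex_solution_def
  proof (intro conjI allI impI ballI sol)
    fix S y assume y: "vortex_solution N m p0 S y"
    show "S \<le> Tc" by (rule vortex_solution_tendsto_maximal[OF sol y N xlim])
    \<comment> \<open>Since \<open>S \<le> Tc\<close>, every \<open>t\<close> in
      \<open>{0..<S}\<close> lies in the lifetime of both solutions.\<close>
    then show "y j t = x j t" if "j \<in> {1..N}" "t \<in> {0..<S}" for j t
      using vortex_solution_unique[OF sol y _ _ _ that(1)] that(2) by simp
  qed
  moreover have "collision_cluster N x"
    by (rule vortex_solution_collision_cluster[OF sol N xlim])
  moreover have "x j t = sqrt (\<rho>1 t) *\<^sub>R unit_vec (\<theta> j) \<and> x (n + j) t = sqrt (\<rho>2 t) *\<^sub>R unit_vec (\<alpha> j)"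
    if "j \<in> {1..n}" for j t
    using that by (simp add: x_def \<rho>_def \<phi>_def)
  ultimately show ?thesis
    using pos lim by (intro exI[of _ x] conjI exI[of _ \<rho>1] exI[of _ \<rho>2]) auto
qed

end
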